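(* Let $I$ and $\mathcal{A}$ be $2$-categories and let $F\colon I\to\mathcal{A}$ be a $2$-functor. A pseudo-limit (resp. lax-limit) of $F$ is $2$-terminal in the strict-slice of pseudo-cones (resp. lax-cones) over $F$.
   Context: $2$-categories and $2$-functors are strict; $*$ denotes horizontal composition (and whiskering) of $2$-morphisms and juxtaposition denotes vertical composition. A lax-natural transformation $\mu\colon F\Rightarrow G$ between $2$-functors $F,G\colon I\to\mathcal{A}$ consists of morphisms $\mu_i\colon Fi\to Gi$ for $i\in I$ and $2$-morphisms $\mu_f\colon(Gf)\mu_i\Rightarrow\mu_j(Ff)$ for $f\colon i\to j$ in $I$, such that $\mu_{\mathrm{id}_i}=\mathrm{id}_{\mu_i}$, $\mu_{gf}=(\mu_g*Ff)(Gg*\mu_f)$ for composable $f,g$, and $\mu_g(G\alpha*\mu_i)=(\mu_j*F\alpha)\mu_f$ for every $2$-morphism $\alpha\colon f\Rightarrow g$ in $I$. It is pseudo-natural if every $\mu_f$ is invertible. A modification $\varphi\colon\mu\to\nu$ between lax- (or pseudo-) natural transformations consists of $2$-morphisms $\varphi_i\colon\mu_i\Rightarrow\nu_i$ with $\nu_f(Gf*\varphi_i)=(\varphi_j*Ff)\mu_f$ for every $f\colon i\to j$. $\mathrm{Lax}[I,\mathcal{A}]$ (resp. $\mathrm{Ps}[I,\mathcal{A}]$) is the $2$-category of $2$-functors $I\to\mathcal{A}$, lax- (resp. pseudo-) natural transformations and modifications. $\Delta X$ is the constant $2$-functor at $X$. A pseudo-cone (resp. lax-cone) over $F$ is a pseudo-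 (resp. lax-) natural transformation $\Delta X\Rightarrow F$. A pseudo-limit (resp. lax-limit) of $F$ is an object $L\in\mathcal{A}$ with a pseudo-cone (resp. lax-cone) $\lambda\colon\Delta L\Rightarrow F$ such that for each $X\in\mathcal{A}$ the functor $\lambda_*\circ\Delta\colon\mathcal{A}(X,L)\to\mathrm{Ps}[I,\mathcal{A}](\Delta X,F)$ (resp. $\mathcal{A}(X,L)\to\mathrm{Lax}[I,\mathcal{A}](\Delta X,F)$), given by post-composition with $\lambda$, is an isomorphism of categories. The strict-slice of pseudo-cones (resp. lax-cones) over $F$ is the $2$-category whose objects are pairs $(X,\mu)$ with $\mu\colon\Delta X\Rightarrow F$ a pseudo-cone (resp. lax-cone); morphisms $(X,\mu)\to(Y,\nu)$ are morphisms $f\colon X\to Y$ of $\mathcal{A}$ with $\nu\Delta f=\mu$; $2$-morphisms $f\Rightarrow g$ are $2$-morphisms $\alpha\colon f\Rightarrow g$ of $\mathcal{A}$ with $\nu*\Delta\alpha=\mathrm{id}_\mu$. An object $L$ of a $2$-category $\mathcal{B}$ is $2$-terminal if for all $X\in\mathcal{B}$ the category $\mathcal{B}(X,L)$ is isomorphic to the terminal category $\mathbb{1}$. *)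

theory Defs
  imports "HOL-Library.FuncSet"
begin

section \<open>Categories and functors\<close>

record ('o, 'a) cat =
  Obj :: "'o set"
  Arr :: "'a set"
  Dom :: "'a \<Rightarrow> 'o"
  Cod :: "'a \<Rightarrow> 'o"
  Idn :: "'o \<Rightarrow> 'a"
  Cmp :: "'a \<Rightarrow> 'a \<Rightarrow> 'a"

text \<open>All compositions are written in applicative order: \<open>Cmp C g f\<close> is \<open>g\<close> after \<open>f\<close>.\<close>

locale category =
  fixes C :: "('o, 'a) cat"
  assumes Dom_in: "a \<in> Arr C \<Longrightarrow> Dom C a \<in> Obj C"
    and Cod_in: "a \<in> Arr C \<Longrightarrow> Cod C a \<in> Obj C"
    and Idn_in: "x \<in> Obj C \<Longrightarrow> Idn C x \<in> Arr C"
    and Dom_Idn: "x \<in> Obj C \<Longrightarrow> Dom C (Idn C x) = x"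
    and Cod_Idn: "x \<in> Obj C \<Longrightarrow> Cod C (Idn C x) = x"
    and Cmp_in: "\<lbrakk>a \<in> Arr C; b \<in> Arr C; Dom C b = Cod C a\<rbrakk> \<Longrightarrow> Cmp C b a \<in> Arr C"
    and Dom_Cmp: "\<lbrakk>a \<in> Arr C; b \<in> Arr C; Dom C b = Cod C a\<rbrakk> \<Longrightarrow> Dom C (Cmp C b a) = Dom C a"
    and Cod_Cmp: "\<lbrakk>a \<in> Arr C; b \<in> Arr C; Dom C b = Cod C a\<rbrakk> \<Longrightarrow> Cod C (Cmp C b a) = Cod C b"
    and Cmp_Idn_right: "a \<in> Arr C \<Longrightarrow> Cmp C a (Idn C (Dom C a)) = a"
    and Cmp_Idn_left: "a \<in> Arr C \<Longrightarrow> Cmp C (Idn C (Cod C a)) a = a"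
    and Cmp_assoc: "\<lbrakk>a \<in> Arr C; b \<in> Arr C; c \<in> Arr C; Dom C b = Cod C a; Dom C c = Cod C b\<rbrakk>
      \<Longrightarrow> Cmp C (Cmp C c b) a = Cmp C c (Cmp C b a)"

record ('o, 'a, 'p, 'b) fctr =
  on_Obj :: "'o \<Rightarrow> 'p"
  on_Arr :: "'a \<Rightarrow> 'b"

locale cat_functor = S: category C + T: category D
  for C :: "('o, 'a) cat" and D :: "('p, 'b) cat" +
  fixes T :: "('o, 'a, 'p, 'b) fctr"
  assumes on_Obj_in: "x \<in> Obj C \<Longrightarrow> on_Obj T x \<in> Obj D"
    and on_Arr_in: "a \<in> Arr C \<Longrightarrow> on_Arr T a \<in> Arr D"
    and Dom_on_Arr: "a \<in> Arr C \<Longrightarrow> Dom D (on_Arr T a) = on_Obj T (Dom C a)"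
    and Cod_on_Arr: "a \<in> Arr C \<Longrightarrow> Cod D (on_Arr T a) = on_Obj T (Cod C a)"
    and on_Arr_Idn: "x \<in> Obj C \<Longrightarrow> on_Arr T (Idn C x) = Idn D (on_Obj T x)"
    and on_Arr_Cmp: "\<lbrakk>a \<in> Arr C; b \<in> Arr C; Dom C b = Cod C a\<rbrakk>
      \<Longrightarrow> on_Arr T (Cmp C b a) = Cmp D (on_Arr T b) (on_Arr T a)"

definition inverse_functors ::
  "('o, 'a) cat \<Rightarrow> ('p, 'b) cat \<Rightarrow> ('o, 'a, 'p, 'b) fctr \<Rightarrow> ('p, 'b, 'o, 'a) fctr \<Rightarrow> bool" where
  "inverse_functors C D S T \<longleftrightarrow>
     cat_functor C D S \<and> cat_functor D C T \<and>
     (\<forall>x \<in> Obj C. on_Obj T (on_Obj S x) = x) \<and> (\<forall>a \<in> Arr C. on_Arr T (on_Arr S a) = a) \<and>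
     (\<forall>y \<in> Obj D. on_Obj S (on_Obj T y) = y) \<and> (\<forall>b \<in> Arr D. on_Arr S (on_Arr T b) = b)"

definition iso_of_categories :: "('o, 'a) cat \<Rightarrow> ('p, 'b) cat \<Rightarrow> ('o, 'a, 'p, 'b) fctr \<Rightarrow> bool" where
  "iso_of_categories C D S \<longleftrightarrow> (\<exists>T. inverse_functors C D S T)"

definition isomorphic_categories :: "('o, 'a) cat \<Rightarrow> ('p, 'b) cat \<Rightarrow> bool" where
  "isomorphic_categories C D \<longleftrightarrow> (\<exists>S. iso_of_categories C D S)"

definition terminal_cat :: "(unit, unit) cat" where
  "terminal_cat = \<lparr>Obj = UNIV, Arr = UNIV, Dom = (\<lambda>_. ()), Cod = (\<lambda>_. ()),
     Idn = (\<lambda>_. ()), Cmp = (\<lambda>_ _. ())\<rparr>"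


section \<open>Strict 2-categories and strict 2-functors\<close>

record ('o, 'm, 'c) two_cat =
  Ob :: "'o set"
  Mor :: "'m set"
  Cell :: "'c set"
  dom1 :: "'m \<Rightarrow> 'o"
  cod1 :: "'m \<Rightarrow> 'o"
  dom2 :: "'c \<Rightarrow> 'm"
  cod2 :: "'c \<Rightarrow> 'm"
  id1 :: "'o \<Rightarrow> 'm"
  comp1 :: "'m \<Rightarrow> 'm \<Rightarrow> 'm"
  id2 :: "'m \<Rightarrow> 'c"
  vcomp :: "'c \<Rightarrow> 'c \<Rightarrow> 'c"
  hcomp :: "'c \<Rightarrow> 'c \<Rightarrow> 'c"

definition one_cells :: "('o, 'm, 'c) two_cat \<Rightarrow> ('o, 'm) cat" where
  "one_cells A = \<lparr>Obj = Ob A, Arr = Mor A, Dom = dom1 A, Cod = cod1 A, Idn = id1 A, Cmp = comp1 A\<rparr>"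

definition vertical :: "('o, 'm, 'c) two_cat \<Rightarrow> ('m, 'c) cat" where
  "vertical A = \<lparr>Obj = Mor A, Arr = Cell A, Dom = dom2 A, Cod = cod2 A, Idn = id2 A, Cmp = vcomp A\<rparr>"

definition horizontal :: "('o, 'm, 'c) two_cat \<Rightarrow> ('o, 'c) cat" where
  "horizontal A = \<lparr>Obj = Ob A, Arr = Cell A, Dom = (\<lambda>\<alpha>. dom1 A (dom2 A \<alpha>)),
     Cod = (\<lambda>\<alpha>. cod1 A (cod2 A \<alpha>)), Idn = (\<lambda>x. id2 A (id1 A x)), Cmp = hcomp A\<rparr>"

text \<open>A 2-category is presented by its three underlying categories (1-cells; 2-cells under vertical
  composition; 2-cells under horizontal composition), globularity, and functoriality of
  horizontal composition with respect to vertical composition.\<close>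

locale two_category =
  O: category "one_cells A" + V: category "vertical A" + H: category "horizontal A"
  for A :: "('o, 'm, 'c) two_cat" +
  assumes glob_dom: "\<alpha> \<in> Cell A \<Longrightarrow> dom1 A (dom2 A \<alpha>) = dom1 A (cod2 A \<alpha>)"
    and glob_cod: "\<alpha> \<in> Cell A \<Longrightarrow> cod1 A (dom2 A \<alpha>) = cod1 A (cod2 A \<alpha>)"
    and dom2_hcomp: "\<lbrakk>\<alpha> \<in> Cell A; \<beta> \<in> Cell A; dom1 A (dom2 A \<beta>) = cod1 A (dom2 A \<alpha>)\<rbrakk>
      \<Longrightarrow> dom2 A (hcomp A \<beta> \<alpha>) = comp1 A (dom2 A \<beta>) (dom2 A \<alpha>)"
    and cod2_hcomp: "\<lbrakk>\<alpha> \<in> Cell A; \<beta> \<in> Cell A; dom1 A (dom2 A \<beta>) = cod1 A (dom2 A \<alpha>)\<rbrakk>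
      \<Longrightarrow> cod2 A (hcomp A \<beta> \<alpha>) = comp1 A (cod2 A \<beta>) (cod2 A \<alpha>)"
    and hcomp_id2: "\<lbrakk>f \<in> Mor A; g \<in> Mor A; dom1 A g = cod1 A f\<rbrakk>
      \<Longrightarrow> hcomp A (id2 A g) (id2 A f) = id2 A (comp1 A g f)"
    and interchange: "\<lbrakk>\<alpha> \<in> Cell A; \<alpha>' \<in> Cell A; \<beta> \<in> Cell A; \<beta>' \<in> Cell A;
        dom2 A \<alpha>' = cod2 A \<alpha>; dom2 A \<beta>' = cod2 A \<beta>; dom1 A (dom2 A \<beta>) = cod1 A (dom2 A \<alpha>)\<rbrakk>
      \<Longrightarrow> hcomp A (vcomp A \<beta>' \<beta>) (vcomp A \<alpha>' \<alpha>) = vcomp A (hcomp A \<beta>' \<alpha>') (hcomp A \<beta> \<alpha>)"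

definition hom_cat :: "('o, 'm, 'c) two_cat \<Rightarrow> 'o \<Rightarrow> 'o \<Rightarrow> ('m, 'c) cat" where
  "hom_cat A X Y = \<lparr>Obj = {f \<in> Mor A. dom1 A f = X \<and> cod1 A f = Y},
     Arr = {\<alpha> \<in> Cell A. dom1 A (dom2 A \<alpha>) = X \<and> cod1 A (dom2 A \<alpha>) = Y},
     Dom = dom2 A, Cod = cod2 A, Idn = id2 A, Cmp = vcomp A\<rparr>"

definition two_terminal :: "('o, 'm, 'c) two_cat \<Rightarrow> 'o \<Rightarrow> bool" where
  "two_terminal B L \<longleftrightarrow>
     L \<in> Ob B \<and> (\<forall>X \<in> Ob B. isomorphic_categories (hom_cat B X L) terminal_cat)"

definition whisker_left :: "('o, 'm, 'c) two_cat \<Rightarrow> 'm \<Rightarrow> 'c \<Rightarrow> 'c" where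
  "whisker_left A g \<alpha> = hcomp A (id2 A g) \<alpha>"

definition whisker_right :: "('o, 'm, 'c) two_cat \<Rightarrow> 'c \<Rightarrow> 'm \<Rightarrow> 'c" where
  "whisker_right A \<beta> f = hcomp A \<beta> (id2 A f)"

definition invertible2 :: "('o, 'm, 'c) two_cat \<Rightarrow> 'c \<Rightarrow> bool" where
  "invertible2 A \<alpha> \<longleftrightarrow> \<alpha> \<in> Cell A \<and> (\<exists>\<beta> \<in> Cell A. dom2 A \<beta> = cod2 A \<alpha> \<and> cod2 A \<beta> = dom2 A \<alpha> \<and>
     vcomp A \<beta> \<alpha> = id2 A (dom2 A \<alpha>) \<and> vcomp A \<alpha> \<beta> = id2 A (cod2 A \<alpha>))"

record ('i, 'u, 'x, 'o, 'm, 'c) two_fun =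
  fob :: "'i \<Rightarrow> 'o"
  fmor :: "'u \<Rightarrow> 'm"
  fcell :: "'x \<Rightarrow> 'c"

text \<open>The action of a 2-functor is required to be \<^const>\<open>undefined\<close> outside its domain (and likewise
  for the components of transformations and modifications below), so that equality in HOL is
  equality of 2-functors, transformations and modifications.\<close>

locale two_functor = S: two_category I + T: two_category A
  for I :: "('i, 'u, 'x) two_cat" and A :: "('o, 'm, 'c) two_cat" +
  fixes F :: "('i, 'u, 'x, 'o, 'm, 'c) two_fun"
  assumes functor_one_cells:
      "cat_functor (one_cells I) (one_cells A) \<lparr>on_Obj = fob F, on_Arr = fmor F\<rparr>"
    and functor_vertical:
      "cat_functor (vertical I) (vertical A) \<lparr>on_Obj = fmor F, on_Arr = fcell F\<rparr>"
    and functor_horizontal: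
      "cat_functor (horizontal I) (horizontal A) \<lparr>on_Obj = fob F, on_Arr = fcell F\<rparr>"
    and fob_ext: "fob F \<in> extensional (Ob I)"
    and fmor_ext: "fmor F \<in> extensional (Mor I)"
    and fcell_ext: "fcell F \<in> extensional (Cell I)"


section \<open>Transformations and modifications\<close>

record ('i, 'u, 'x, 'o, 'm, 'c) trans =
  tdom :: "('i, 'u, 'x, 'o, 'm, 'c) two_fun"
  tcod :: "('i, 'u, 'x, 'o, 'm, 'c) two_fun"
  tob :: "'i \<Rightarrow> 'm"
  tmor :: "'u \<Rightarrow> 'c"

locale lax_natural =
  S: two_functor I A "tdom \<mu>" + T: two_functor I A "tcod \<mu>"
  for I :: "('i, 'u, 'x) two_cat" and A :: "('o, 'm, 'c) two_cat"
    and \<mu> :: "('i, 'u, 'x, 'o, 'm, 'c) trans" +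
  assumes tob_in: "i \<in> Ob I \<Longrightarrow> tob \<mu> i \<in> Mor A"
    and dom_tob: "i \<in> Ob I \<Longrightarrow> dom1 A (tob \<mu> i) = fob (tdom \<mu>) i"
    and cod_tob: "i \<in> Ob I \<Longrightarrow> cod1 A (tob \<mu> i) = fob (tcod \<mu>) i"
    and tmor_in: "f \<in> Mor I \<Longrightarrow> tmor \<mu> f \<in> Cell A"
    and dom_tmor: "f \<in> Mor I \<Longrightarrow>
      dom2 A (tmor \<mu> f) = comp1 A (fmor (tcod \<mu>) f) (tob \<mu> (dom1 I f))"
    and cod_tmor: "f \<in> Mor I \<Longrightarrow>
      cod2 A (tmor \<mu> f) = comp1 A (tob \<mu> (cod1 I f)) (fmor (tdom \<mu>) f)"
    and tmor_id1: "i \<in> Ob I \<Longrightarrow> tmor \<mu> (id1 I i) = id2 A (tob \<mu> i)"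
    and tmor_comp1: "\<lbrakk>f \<in> Mor I; g \<in> Mor I; dom1 I g = cod1 I f\<rbrakk> \<Longrightarrow>
      tmor \<mu> (comp1 I g f) =
        vcomp A (whisker_right A (tmor \<mu> g) (fmor (tdom \<mu>) f))
                (whisker_left A (fmor (tcod \<mu>) g) (tmor \<mu> f))"
    and tmor_nat: "\<alpha> \<in> Cell I \<Longrightarrow>
      vcomp A (tmor \<mu> (cod2 I \<alpha>)) (whisker_right A (fcell (tcod \<mu>) \<alpha>) (tob \<mu> (dom1 I (dom2 I \<alpha>)))) =
      vcomp A (whisker_left A (tob \<mu> (cod1 I (dom2 I \<alpha>))) (fcell (tdom \<mu>) \<alpha>)) (tmor \<mu> (dom2 I \<alpha>))"
    and tob_ext: "tob \<mu> \<in> extensional (Ob I)"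
    and tmor_ext: "tmor \<mu> \<in> extensional (Mor I)"

locale pseudo_natural = lax_natural +
  assumes tmor_invertible: "f \<in> Mor I \<Longrightarrow> invertible2 A (tmor \<mu> f)"

record ('i, 'u, 'x, 'o, 'm, 'c) modif =
  mdom :: "('i, 'u, 'x, 'o, 'm, 'c) trans"
  mcod :: "('i, 'u, 'x, 'o, 'm, 'c) trans"
  mob :: "'i \<Rightarrow> 'c"

locale modification =
  S: lax_natural I A "mdom \<phi>" + T: lax_natural I A "mcod \<phi>"
  for I :: "('i, 'u, 'x) two_cat" and A :: "('o, 'm, 'c) two_cat"
    and \<phi> :: "('i, 'u, 'x, 'o, 'm, 'c) modif" +
  assumes tdom_eq: "tdom (mdom \<phi>) = tdom (mcod \<phi>)"
    and tcod_eq: "tcod (mdom \<phi>) = tcod (mcod \<phi>)"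
    and mob_in: "i \<in> Ob I \<Longrightarrow> mob \<phi> i \<in> Cell A"
    and dom_mob: "i \<in> Ob I \<Longrightarrow> dom2 A (mob \<phi> i) = tob (mdom \<phi>) i"
    and cod_mob: "i \<in> Ob I \<Longrightarrow> cod2 A (mob \<phi> i) = tob (mcod \<phi>) i"
    and mob_nat: "f \<in> Mor I \<Longrightarrow>
      vcomp A (tmor (mcod \<phi>) f) (whisker_left A (fmor (tcod (mdom \<phi>)) f) (mob \<phi> (dom1 I f))) =
      vcomp A (whisker_right A (mob \<phi> (cod1 I f)) (fmor (tdom (mdom \<phi>)) f)) (tmor (mdom \<phi>) f)"
    and mob_ext: "mob \<phi> \<in> extensional (Ob I)"


section \<open>The 2-categories of 2-functors\<close>

definition id_trans :: "('i, 'u, 'x) two_cat \<Rightarrow> ('o, 'm, 'c) two_cat \<Rightarrow>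
    ('i, 'u, 'x, 'o, 'm, 'c) two_fun \<Rightarrow> ('i, 'u, 'x, 'o, 'm, 'c) trans" where
  "id_trans I A F = \<lparr>tdom = F, tcod = F,
     tob = (\<lambda>i \<in> Ob I. id1 A (fob F i)),
     tmor = (\<lambda>f \<in> Mor I. id2 A (fmor F f))\<rparr>"

text \<open>For \<open>\<mu>: F \<Rightarrow> G\<close>, \<open>\<nu>: G \<Rightarrow> H\<close> and \<open>f: i \<rightarrow> j\<close>, the 2-cell of \<open>\<nu>\<mu>\<close> at \<open>f\<close> is the pasting
  \<open>(Hf) \<nu>\<^sub>i \<mu>\<^sub>i \<Rightarrow> \<nu>\<^sub>j (Gf) \<mu>\<^sub>i \<Rightarrow> \<nu>\<^sub>j \<mu>\<^sub>j (Ff)\<close>.\<close>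

definition comp_trans :: "('i, 'u, 'x) two_cat \<Rightarrow> ('o, 'm, 'c) two_cat \<Rightarrow>
    ('i, 'u, 'x, 'o, 'm, 'c) trans \<Rightarrow> ('i, 'u, 'x, 'o, 'm, 'c) trans \<Rightarrow>
    ('i, 'u, 'x, 'o, 'm, 'c) trans" where
  "comp_trans I A \<nu> \<mu> = \<lparr>tdom = tdom \<mu>, tcod = tcod \<nu>,
     tob = (\<lambda>i \<in> Ob I. comp1 A (tob \<nu> i) (tob \<mu> i)),
     tmor = (\<lambda>f \<in> Mor I.
       vcomp A (whisker_left A (tob \<nu> (cod1 I f)) (tmor \<mu> f))
               (whisker_right A (tmor \<nu> f) (tob \<mu> (dom1 I f))))\<rparr>"

definition id_modif :: "('i, 'u, 'x) two_cat \<Rightarrow> ('o, 'm, 'c) two_cat \<Rightarrow>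
    ('i, 'u, 'x, 'o, 'm, 'c) trans \<Rightarrow> ('i, 'u, 'x, 'o, 'm, 'c) modif" where
  "id_modif I A \<mu> = \<lparr>mdom = \<mu>, mcod = \<mu>, mob = (\<lambda>i \<in> Ob I. id2 A (tob \<mu> i))\<rparr>"

definition vcomp_modif :: "('i, 'u, 'x) two_cat \<Rightarrow> ('o, 'm, 'c) two_cat \<Rightarrow>
    ('i, 'u, 'x, 'o, 'm, 'c) modif \<Rightarrow> ('i, 'u, 'x, 'o, 'm, 'c) modif \<Rightarrow>
    ('i, 'u, 'x, 'o, 'm, 'c) modif" where
  "vcomp_modif I A \<psi> \<phi> = \<lparr>mdom = mdom \<phi>, mcod = mcod \<psi>,
     mob = (\<lambda>i \<in> Ob I. vcomp A (mob \<psi> i) (mob \<phi> i))\<rparr>"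

definition hcomp_modif :: "('i, 'u, 'x) two_cat \<Rightarrow> ('o, 'm, 'c) two_cat \<Rightarrow>
    ('i, 'u, 'x, 'o, 'm, 'c) modif \<Rightarrow> ('i, 'u, 'x, 'o, 'm, 'c) modif \<Rightarrow>
    ('i, 'u, 'x, 'o, 'm, 'c) modif" where
  "hcomp_modif I A \<psi> \<phi> = \<lparr>mdom = comp_trans I A (mdom \<psi>) (mdom \<phi>),
     mcod = comp_trans I A (mcod \<psi>) (mcod \<phi>),
     mob = (\<lambda>i \<in> Ob I. hcomp A (mob \<psi> i) (mob \<phi> i))\<rparr>"

type_synonym ('i, 'u, 'x, 'o, 'm, 'c) fun_two_cat =
  "(('i, 'u, 'x, 'o, 'm, 'c) two_fun, ('i, 'u, 'x, 'o, 'm, 'c) trans,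
    ('i, 'u, 'x, 'o, 'm, 'c) modif) two_cat"

definition Lax :: "('i, 'u, 'x) two_cat \<Rightarrow> ('o, 'm, 'c) two_cat \<Rightarrow>
    ('i, 'u, 'x, 'o, 'm, 'c) fun_two_cat" where
  "Lax I A = \<lparr>Ob = {F. two_functor I A F}, Mor = {\<mu>. lax_natural I A \<mu>},
     Cell = {\<phi>. modification I A \<phi>},
     dom1 = tdom, cod1 = tcod, dom2 = mdom, cod2 = mcod,
     id1 = id_trans I A, comp1 = comp_trans I A,
     id2 = id_modif I A, vcomp = vcomp_modif I A, hcomp = hcomp_modif I A\<rparr>"

definition Ps :: "('i, 'u, 'x) two_cat \<Rightarrow> ('o, 'm, 'c) two_cat \<Rightarrow>
    ('i, 'u, 'x, 'o, 'm, 'c) fun_two_cat" where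
  "Ps I A = (Lax I A)\<lparr>Mor := {\<mu>. pseudo_natural I A \<mu>},
     Cell := {\<phi>. modification I A \<phi> \<and> pseudo_natural I A (mdom \<phi>) \<and> pseudo_natural I A (mcod \<phi>)}\<rparr>"


section \<open>Cones, limits and strict slices\<close>

definition const_fun :: "('i, 'u, 'x) two_cat \<Rightarrow> ('o, 'm, 'c) two_cat \<Rightarrow> 'o \<Rightarrow>
    ('i, 'u, 'x, 'o, 'm, 'c) two_fun" where
  "const_fun I A X = \<lparr>fob = (\<lambda>_ \<in> Ob I. X), fmor = (\<lambda>_ \<in> Mor I. id1 A X),
     fcell = (\<lambda>_ \<in> Cell I. id2 A (id1 A X))\<rparr>"

definition const_trans :: "('i, 'u, 'x) two_cat \<Rightarrow> ('o, 'm, 'c) two_cat \<Rightarrow> 'm \<Rightarrow>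
    ('i, 'u, 'x, 'o, 'm, 'c) trans" where
  "const_trans I A f = \<lparr>tdom = const_fun I A (dom1 A f), tcod = const_fun I A (cod1 A f),
     tob = (\<lambda>_ \<in> Ob I. f), tmor = (\<lambda>_ \<in> Mor I. id2 A f)\<rparr>"

definition const_modif :: "('i, 'u, 'x) two_cat \<Rightarrow> ('o, 'm, 'c) two_cat \<Rightarrow> 'c \<Rightarrow>
    ('i, 'u, 'x, 'o, 'm, 'c) modif" where
  "const_modif I A \<alpha> = \<lparr>mdom = const_trans I A (dom2 A \<alpha>), mcod = const_trans I A (cod2 A \<alpha>),
     mob = (\<lambda>_ \<in> Ob I. \<alpha>)\<rparr>"

text \<open>Below, \<open>K\<close> is either \<^const>\<open>Lax\<close> \<open>I A\<close> or \<^const>\<open>Ps\<close> \<open>I A\<close>.\<close>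

definition cone :: "('i, 'u, 'x, 'o, 'm, 'c) fun_two_cat \<Rightarrow> ('i, 'u, 'x) two_cat \<Rightarrow>
    ('o, 'm, 'c) two_cat \<Rightarrow> ('i, 'u, 'x, 'o, 'm, 'c) two_fun \<Rightarrow> 'o \<Rightarrow>
    ('i, 'u, 'x, 'o, 'm, 'c) trans \<Rightarrow> bool" where
  "cone K I A F X \<mu> \<longleftrightarrow> X \<in> Ob A \<and> \<mu> \<in> Mor K \<and> dom1 K \<mu> = const_fun I A X \<and> cod1 K \<mu> = F"

text \<open>The functor \<open>\<lambda>\<^sub>* \<circ> \<Delta>\<close>.\<close>

definition postcomp :: "('i, 'u, 'x, 'o, 'm, 'c) fun_two_cat \<Rightarrow> ('i, 'u, 'x) two_cat \<Rightarrow>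
    ('o, 'm, 'c) two_cat \<Rightarrow> ('i, 'u, 'x, 'o, 'm, 'c) trans \<Rightarrow>
    ('m, 'c, ('i, 'u, 'x, 'o, 'm, 'c) trans, ('i, 'u, 'x, 'o, 'm, 'c) modif) fctr" where
  "postcomp K I A lam = \<lparr>on_Obj = (\<lambda>f. comp1 K lam (const_trans I A f)),
     on_Arr = (\<lambda>\<alpha>. whisker_left K lam (const_modif I A \<alpha>))\<rparr>"

definition is_limit :: "('i, 'u, 'x, 'o, 'm, 'c) fun_two_cat \<Rightarrow> ('i, 'u, 'x) two_cat \<Rightarrow>
    ('o, 'm, 'c) two_cat \<Rightarrow> ('i, 'u, 'x, 'o, 'm, 'c) two_fun \<Rightarrow> 'o \<Rightarrow>
    ('i, 'u, 'x, 'o, 'm, 'c) trans \<Rightarrow> bool" where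
  "is_limit K I A F L lam \<longleftrightarrow> cone K I A F L lam \<and>
     (\<forall>X \<in> Ob A. iso_of_categories (hom_cat A X L) (hom_cat K (const_fun I A X) F)
        (postcomp K I A lam))"

text \<open>A morphism \<open>f: (X, \<mu>) \<rightarrow> (Y, \<nu>)\<close> of the slice is the triple of \<open>(X, \<mu>)\<close>, \<open>(Y, \<nu>)\<close> and \<open>f\<close>, since
  \<open>f\<close> alone determines neither cone. A 2-cell \<open>\<alpha>\<close> between parallel such morphisms is encoded
  likewise; its source and target are recovered from those of \<open>\<alpha>\<close> in \<open>A\<close>.\<close>

definition strict_slice :: "('i, 'u, 'x, 'o, 'm, 'c) fun_two_cat \<Rightarrow> ('i, 'u, 'x) two_cat \<Rightarrow>
    ('o, 'm, 'c) two_cat \<Rightarrow> ('i, 'u, 'x, 'o, 'm, 'c) two_fun \<Rightarrow>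
    ('o \<times> ('i, 'u, 'x, 'o, 'm, 'c) trans,
     ('o \<times> ('i, 'u, 'x, 'o, 'm, 'c) trans) \<times> ('o \<times> ('i, 'u, 'x, 'o, 'm, 'c) trans) \<times> 'm,
     ('o \<times> ('i, 'u, 'x, 'o, 'm, 'c) trans) \<times> ('o \<times> ('i, 'u, 'x, 'o, 'm, 'c) trans) \<times> 'c) two_cat"
where
  "strict_slice K I A F =
    (let
       O' = {(X, \<mu>). cone K I A F X \<mu>};
       M' = {((X, \<mu>), (Y, \<nu>), f). (X, \<mu>) \<in> O' \<and> (Y, \<nu>) \<in> O' \<and> f \<in> Mor A \<and>
              dom1 A f = X \<and> cod1 A f = Y \<and> comp1 K \<nu> (const_trans I A f) = \<mu>};
       C' = {((X, \<mu>), (Y, \<nu>), \<alpha>). \<alpha> \<in> Cell A \<and>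
              ((X, \<mu>), (Y, \<nu>), dom2 A \<alpha>) \<in> M' \<and> ((X, \<mu>), (Y, \<nu>), cod2 A \<alpha>) \<in> M' \<and>
              whisker_left K \<nu> (const_modif I A \<alpha>) = id2 K \<mu>}
     in \<lparr>Ob = O', Mor = M', Cell = C',
         dom1 = (\<lambda>(x, y, f). x), cod1 = (\<lambda>(x, y, f). y),
         dom2 = (\<lambda>(x, y, \<alpha>). (x, y, dom2 A \<alpha>)), cod2 = (\<lambda>(x, y, \<alpha>). (x, y, cod2 A \<alpha>)),
         id1 = (\<lambda>(X, \<mu>). ((X, \<mu>), (X, \<mu>), id1 A X)),
         comp1 = (\<lambda>(y, z, g) (x, _, f). (x, z, comp1 A g f)),
         id2 = (\<lambda>(x, y, f). (x, y, id2 A f)),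
         vcomp = (\<lambda>(x, y, \<beta>) (_, _, \<alpha>). (x, y, vcomp A \<beta> \<alpha>)),
         hcomp = (\<lambda>(y, z, \<beta>) (x, _, \<alpha>). (x, z, hcomp A \<beta> \<alpha>))\<rparr>)"

abbreviation "pseudo_limit I A \<equiv> is_limit (Ps I A) I A"
abbreviation "lax_limit I A \<equiv> is_limit (Lax I A) I A"
abbreviation "slice_pseudo_cones I A \<equiv> strict_slice (Ps I A) I A"
abbreviation "slice_lax_cones I A \<equiv> strict_slice (Lax I A) I A"

end

(* Objects and arrows of the hom-category of the strict-slice from (X, mu) to a limit (L, lam) are
   the fibres over mu and over the identity of mu of the isomorphism of categories that
   post-composes with lam. An isomorphism is bijective on objects and on arrows and preserves
   identities, so these fibres consist of one morphism and of its identity. The argument is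
   the same for pseudo- and lax-cones. *)

theory Submission
  imports Defs
begin

text \<open>With one object and one arrow the category laws reduce to the listed equations, so this
  applies to a hom-category of the strict-slice before the slice is known to be a
  2-category.\<close>

lemma isomorphic_terminal_cat_if_singleton:
  assumes C: "Obj C = {x}" "Arr C = {a}"
    and x: "Idn C x = a" and a: "Dom C a = x" "Cod C a = x" "Cmp C a a = a"
  shows "isomorphic_categories C terminal_cat"
proof -
  let ?S = "\<lparr>on_Obj = \<lambda>_. (), on_Arr = \<lambda>_. ()\<rparr>"
  let ?T = "\<lparr>on_Obj = \<lambda>_. x, on_Arr = \<lambda>_. a\<rparr>"
  have cats: "category C" "category terminal_cat"
    by (unfold_locales; simp add: assms terminal_cat_def)+
  have "cat_functor C terminal_cat ?S" "cat_functor terminal_cat C ?T"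
    by (intro cat_functor.intro cat_functor_axioms.intro cats;
        simp add: assms terminal_cat_def)+
  then have "inverse_functors C terminal_cat ?S ?T"
    by (simp add: inverse_functors_def C)
  then show ?thesis
    unfolding isomorphic_categories_def iso_of_categories_def by blast
qed

lemma two_terminal_strict_slice_if_is_limit:
  assumes lim: "is_limit K I A F L lam"
  shows "two_terminal (strict_slice K I A F) (L, lam)"
  unfolding two_terminal_def
proof (intro conjI ballI)
  let ?B = "strict_slice K I A F"
  have L: "cone K I A F L lam"
    using lim by (simp add: is_limit_def)
  then show "(L, lam) \<in> Ob ?B"
    by (simp add: strict_slice_def Let_def)
  fix x assume "x \<in> Ob ?B"
  then obtain X \<mu> where x: "x = (X, \<mu>)" and cone: "cone K I A F X \<mu>"
    by (auto simp: strict_slice_def Let_def)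
  let ?C = "hom_cat A X L" and ?D = "hom_cat K (const_fun I A X) F"
  let ?P = "postcomp K I A lam"
  have "X \<in> Ob A" and \<mu>: "\<mu> \<in> Obj ?D"
    using cone by (auto simp: cone_def hom_cat_def)
  then obtain T where inv: "inverse_functors ?C ?D ?P T"
    using lim unfolding is_limit_def iso_of_categories_def by blast
  \<comment> \<open>These functors bring the category laws of \<open>?C\<close> and
    \<open>?D\<close> with them.\<close>
  interpret P: cat_functor ?C ?D ?P
    using inv by (simp add: inverse_functors_def)
  interpret T: cat_functor ?D ?C T
    using inv by (simp add: inverse_functors_def)
  \<comment> \<open>The factorization of the cone \<open>\<mu>\<close> through
    \<open>lam\<close>.\<close>
  define f where "f = on_Obj T \<mu>"
  have f: "f \<in> Obj ?C" and Pf: "on_Obj ?P f = \<mu>"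
    using \<mu> inv T.on_Obj_in by (auto simp: f_def inverse_functors_def)
  have f_unique: "g = f" if "g \<in> Obj ?C" "on_Obj ?P g = \<mu>" for g
    using that inv by (auto simp: f_def inverse_functors_def)
  have P_id: "on_Arr ?P (Idn ?C f) = Idn ?D \<mu>"
    using P.on_Arr_Idn[OF f] Pf by simp
  \<comment> \<open>The ends of \<open>\<alpha>\<close> are left free: injectivity on arrows already
    forces both to be \<open>f\<close>.\<close>
  have id_unique: "\<alpha> = Idn ?C f" if "\<alpha> \<in> Arr ?C" "on_Arr ?P \<alpha> = Idn ?D \<mu>" for \<alpha>
  proof -
    have "\<alpha> = on_Arr T (on_Arr ?P \<alpha>)"
      using that(1) inv by (simp add: inverse_functors_def)
    also have "\<dots> = Idn ?C f"
      using T.on_Arr_Idn[OF \<mu>] by (simp add: that(2) f_def)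
    finally show ?thesis .
  qed
  note id = P.S.Idn_in[OF f] P.S.Dom_Idn[OF f] P.S.Cod_Idn[OF f]
  have id_id: "Cmp ?C (Idn ?C f) (Idn ?C f) = Idn ?C f"
    using P.S.Cmp_Idn_right[OF id(1)] id(2) by simp
  \<comment> \<open>Both conditions defining the slice unfold to membership in a fibre of
    \<open>?P\<close>: the triangle \<open>lam \<Delta>g = \<mu>\<close> to one over
    \<open>\<mu>\<close>, and below the equation on \<open>\<alpha>\<close> to one over the identity
    of \<open>\<mu>\<close>.\<close>
  have slice_mor: "(x, (L, lam), g) \<in> Mor ?B \<longleftrightarrow> g \<in> Obj ?C \<and> on_Obj ?P g = \<mu>" for g
    using L cone by (auto simp: x strict_slice_def Let_def hom_cat_def postcomp_def)
  have slice_cell: "(x, (L, lam), \<alpha>) \<in> Cell ?B \<longleftrightarrow> \<alpha> \<in> Arr ?C \<and>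
      (x, (L, lam), dom2 A \<alpha>) \<in> Mor ?B \<and> (x, (L, lam), cod2 A \<alpha>) \<in> Mor ?B \<and>
      on_Arr ?P \<alpha> = Idn ?D \<mu>" for \<alpha>
    by (auto simp: x strict_slice_def Let_def hom_cat_def postcomp_def)
  have "(x, (L, lam), g) \<in> Mor ?B \<longleftrightarrow> g = f" for g
    unfolding slice_mor using f Pf f_unique by blast
  moreover have "(x, (L, lam), \<alpha>) \<in> Cell ?B \<longleftrightarrow> \<alpha> = Idn ?C f" for \<alpha>
  proof
    assume "\<alpha> = Idn ?C f"
    moreover from this have "dom2 A \<alpha> = f" "cod2 A \<alpha> = f"
      using id by (simp_all add: hom_cat_def)
    ultimately show "(x, (L, lam), \<alpha>) \<in> Cell ?B"
      unfolding slice_cell slice_mor using f Pf P_id id(1) by simp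
  qed (use id_unique slice_cell in blast)
  ultimately have Obj: "Obj (hom_cat ?B x (L, lam)) = {(x, (L, lam), f)}"
    and Arr: "Arr (hom_cat ?B x (L, lam)) = {(x, (L, lam), id2 A f)}"
    by (auto simp: strict_slice_def Let_def hom_cat_def)
  show "isomorphic_categories (hom_cat ?B x (L, lam)) terminal_cat"
    \<comment> \<open>Identities and vertical composites in the slice are formed on the last
      component, so the laws of \<open>?C\<close> at \<open>f\<close> suffice.\<close>
    using id id_id
    by (intro isomorphic_terminal_cat_if_singleton[OF Obj Arr])
       (simp_all add: strict_slice_def Let_def hom_cat_def)
qed

theorem proposition4p3:
  fixes I :: "('i, 'u, 'x) two_cat" and A :: "('o, 'm, 'c) two_cat"
    and F :: "('i, 'u, 'x, 'o, 'm, 'c) two_fun"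
  assumes "two_category I" and "two_category A" and "two_functor I A F"
  shows "(\<forall>L lam. pseudo_limit I A F L lam \<longrightarrow> two_terminal (slice_pseudo_cones I A F) (L, lam)) \<and>
         (\<forall>L lam. lax_limit I A F L lam \<longrightarrow> two_terminal (slice_lax_cones I A F) (L, lam))"
  by (simp add: two_terminal_strict_slice_if_is_limit)

end
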